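(* $p^2(Q_4) \ge 5$.
   Context: For $n\ge 1$, $Q_n$ is the $n$-dimensional hypercube: the graph with vertex set $\{0,1\}^n$ and edges between vertices differing in exactly one coordinate. An embedding of $Q_d$ in $Q_n$ is a subgraph of $Q_n$ isomorphic to $Q_d$ (equivalently, a $d$-dimensional subcube, obtained by fixing $n-d$ coordinates and letting the other $d$ vary). For $d\ge i\ge 1$, $p^i(Q_d)$ denotes the largest integer $r$ such that for every $n\ge d$ one can assign one of $r$ colors to each embedding of $Q_i$ in $Q_n$ so that every embedding of $Q_d$ in $Q_n$ contains an embedding of $Q_i$ of every one of the $r$ colors. *)

theory Defs
  imports "Graph_Theory.Digraph_Isomorphism"
begin

text \<open>As usual in \<^theory>\<open>Graph_Theory.Pair_Digraph\<close>, an undirected simple graph is a symmetric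
  loop-free digraph, so every edge occurs as two opposite arcs.\<close>

definition hypercube :: "nat \<Rightarrow> bool list pair_pre_digraph" where
  "hypercube n = \<lparr>
     pverts = {x. length x = n},
     parcs = {(x, y). length x = n \<and> length y = n \<and> card {k. k < n \<and> x ! k \<noteq> y ! k} = 1}
   \<rparr>"

text \<open>Symmetry of an embedded copy \<open>H\<close> need not be required separately: it is inherited from
  \<open>hypercube d\<close> along the isomorphism.\<close>

definition embeddings :: "nat \<Rightarrow> nat \<Rightarrow> bool list pair_pre_digraph set" where
  "embeddings d n =
     {H. subgraph (with_proj H) (with_proj (hypercube n)) \<and>
         digraph_iso (with_proj (hypercube d)) (with_proj H)}"

definition polychromatic ::
    "nat \<Rightarrow> nat \<Rightarrow> nat \<Rightarrow> nat \<Rightarrow> (bool list pair_pre_digraph \<Rightarrow> nat) \<Rightarrow> bool" where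
  "polychromatic i d n r c \<longleftrightarrow>
     (\<forall>E \<in> embeddings i n. c E < r) \<and>
     (\<forall>D \<in> embeddings d n. \<forall>k < r.
        \<exists>E \<in> embeddings i n. subgraph (with_proj E) (with_proj D) \<and> c E = k)"

text \<open>The greatest such \<open>r\<close> exists when \<open>1 \<le> i \<le> d\<close>: the condition holds for \<open>r = 1\<close>, and the case
  \<open>n = d\<close> bounds \<open>r\<close> by the number of copies of \<open>hypercube i\<close> in \<open>hypercube d\<close>.\<close>

definition polychromatic_number :: "nat \<Rightarrow> nat \<Rightarrow> nat" where
  "polychromatic_number i d = (GREATEST r. \<forall>n \<ge> d. \<exists>c. polychromatic i d n r c)"

end

theory Submission
  imports Defs
begin

text \<open>A two-dimensional face of the n-cube is a word over 0, 1, star with two stars. Its colour depends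
  only on the numbers of ones before, between and after the stars, taken modulo 3, through a table of 27
  entries. If the ones of a four-dimensional face are distributed over its five gaps as
  (u, v, w, x, y), then each of its 24 faces has its triple given by gap sums plus the
  values (s, t) of the two stars that become fixed; so that all colours occur is a finite check over
  residues modulo 3. Moreover every copy of a cube inside a hypercube is a face: vertices at distance 2
  in a hypercube have only two common neighbours, so opposite edges of a 4-cycle flip the same coordinate.\<close>

section \<open>The colour table and its finite check\<close>

text \<open>The table was found by a SAT solver.\<close>

definition pattern :: "nat list" where
  "pattern = [1, 2, 0, 4, 3, 3, 1, 2, 0,
              0, 1, 4, 3, 4, 1, 0, 3, 2,
              2, 4, 3, 3, 0, 1, 2, 1, 4]"

definition colour :: "nat \<Rightarrow> nat \<Rightarrow> nat \<Rightarrow> nat" where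
  "colour a b c = pattern ! (9 * (a mod 3) + 3 * (b mod 3) + c mod 3)"

text \<open>One disjunct for each pair of stars kept among the four stars of a face with gap counts
  \<open>u, v, w, x, y\<close>; the other two stars are replaced, in this order, by \<open>s\<close> and \<open>t\<close>.\<close>

definition hits :: "nat \<Rightarrow> nat \<Rightarrow> nat \<Rightarrow> nat \<Rightarrow> nat \<Rightarrow> nat \<Rightarrow> nat \<Rightarrow> nat \<Rightarrow> bool" where
  "hits k u v w x y s t \<longleftrightarrow>
     colour u v (w + s + x + t + y) = k \<or>
     colour u (v + s + w) (x + t + y) = k \<or>
     colour u (v + s + w + t + x) y = k \<or>
     colour (u + s + v) w (x + t + y) = k \<or>
     colour (u + s + v) (w + t + x) y = k \<or>
     colour (u + s + v + t + w) x y = k"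

text \<open>Pure evaluation of \<open>5 * 3^5\<close> cases with four choices of
  \<open>(s, t)\<close> each. The bounds are written as sets of lists so that
  \<open>code_simp\<close> can execute the quantifiers.\<close>

lemma hits_residues:
  "\<forall>k \<in> set [0..<5]. \<forall>u \<in> set [0..<3]. \<forall>v \<in> set [0..<3]. \<forall>w \<in> set [0..<3]. \<forall>x \<in> set [0..<3]. \<forall>y \<in> set [0..<3].
     \<exists>s \<in> set [0, 1]. \<exists>t \<in> set [0, 1]. hits k u v w x y s t"
  by code_simp

lemma colour_cong:
  "a mod 3 = a' mod 3 \<Longrightarrow> b mod 3 = b' mod 3 \<Longrightarrow> c mod 3 = c' mod 3 \<Longrightarrow> colour a b c = colour a' b' c'"
  by (simp add: colour_def)

text \<open>Each argument of \<open>colour\<close> in \<open>hits\<close> is a sum of gap counts and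
  bits, and \<open>colour\<close> sees only residues; this lifts the finite check to arbitrary gap
  counts.\<close>

lemma hits_mod_3: "hits k (u mod 3) (v mod 3) (w mod 3) (x mod 3) (y mod 3) s t = hits k u v w x y s t"
  unfolding hits_def
  by (intro arg_cong2[where f = "(\<or>)"] arg_cong[where f = "\<lambda>z. z = k"] colour_cong
      mod_add_cong mod_mod_trivial refl)

lemma ex_hits:
  assumes "k < 5"
  shows "\<exists>s \<in> {0, 1}. \<exists>t \<in> {0, 1}. hits k u v w x y s t"
proof -
  have "k \<in> set [0..<5]" "z mod 3 \<in> set [0..<3]" for z using assms by simp_all
  then have "\<exists>s \<in> set [0, 1]. \<exists>t \<in> set [0, 1].
      hits k (u mod 3) (v mod 3) (w mod 3) (x mod 3) (y mod 3) s t"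
    using hits_residues by blast
  then show ?thesis by (simp add: hits_mod_3)
qed

lemma colour_less: "colour a b c < 5"
proof -
  have "a mod 3 < 3" "b mod 3 < 3" "c mod 3 < 3" by simp_all
  then have "9 * (a mod 3) + 3 * (b mod 3) + c mod 3 < 27" by linarith
  then have "colour a b c \<in> set pattern"
    unfolding colour_def by (intro nth_mem) (simp add: pattern_def)
  moreover have "\<forall>i \<in> set pattern. i < 5" by (simp add: pattern_def)
  ultimately show ?thesis by blast
qed

section \<open>Vertices of the hypercube as sets of coordinates\<close>

text \<open>With vertices as sets, flipping a coordinate is a symmetric difference with a singleton,
  so adjacency and reflections become set algebra.\<close>

definition ones :: "bool list \<Rightarrow> nat set" where
  "ones x = {k. k < length x \<and> x ! k}"

definition of_ones :: "nat \<Rightarrow> nat set \<Rightarrow> bool list" where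
  "of_ones n S = map (\<lambda>k. k \<in> S) [0..<n]"

lemma length_of_ones [simp]: "length (of_ones n S) = n"
  by (simp add: of_ones_def)

lemma ones_of_ones [simp]: "S \<subseteq> {..<n} \<Longrightarrow> ones (of_ones n S) = S"
  by (auto simp: ones_def of_ones_def)

lemma of_ones_ones [simp]: "length x = n \<Longrightarrow> of_ones n (ones x) = x"
  by (auto simp: ones_def of_ones_def intro!: nth_equalityI)

lemma ones_subset: "length x = n \<Longrightarrow> ones x \<subseteq> {..<n}"
  by (auto simp: ones_def)

lemma ones_inject: "ones x = ones y \<Longrightarrow> length x = length y \<Longrightarrow> x = y"
  by (metis of_ones_ones)

lemma pverts_hypercube [simp]: "pverts (hypercube n) = {x. length x = n}"
  by (simp add: hypercube_def)

lemma parcs_hypercube: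
  "(x, y) \<in> parcs (hypercube n) \<longleftrightarrow>
     length x = n \<and> length y = n \<and> card (sym_diff (ones x) (ones y)) = 1"
proof (cases "length x = n \<and> length y = n")
  case True
  then have "{k. k < n \<and> x ! k \<noteq> y ! k} = sym_diff (ones x) (ones y)"
    by (auto simp: ones_def)
  with True show ?thesis by (simp add: hypercube_def)
qed (auto simp: hypercube_def)

lemma wf_hypercube: "wf_digraph (with_proj (hypercube n))"
  by unfold_locales (auto simp: hypercube_def)

section \<open>Faces of the hypercube\<close>

text \<open>Meant for disjoint \<open>P\<close> and \<open>S\<close> below \<open>n\<close>: the
  word with stars at \<open>P\<close>, ones at \<open>S\<close> and zeros elsewhere.\<close>

definition subcube :: "nat \<Rightarrow> nat set \<Rightarrow> nat set \<Rightarrow> bool list pair_pre_digraph" where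
  "subcube n P S =
     (let V = {x. length x = n \<and> S \<subseteq> ones x \<and> ones x \<subseteq> S \<union> P}
      in \<lparr>pverts = V, parcs = parcs (hypercube n) \<inter> V \<times> V\<rparr>)"

lemma pverts_subcube: "pverts (subcube n P S) = {x. length x = n \<and> S \<subseteq> ones x \<and> ones x \<subseteq> S \<union> P}"
  by (simp add: subcube_def Let_def)

lemma parcs_subcube:
  "parcs (subcube n P S) = parcs (hypercube n) \<inter> pverts (subcube n P S) \<times> pverts (subcube n P S)"
  by (simp add: subcube_def Let_def)

lemma wf_subcube: "wf_digraph (with_proj (subcube n P S))"
  by unfold_locales (auto simp: parcs_subcube)

lemma subcube_subgraph_hypercube: "subgraph (with_proj (subcube n P S)) (with_proj (hypercube n))"
  by (auto simp: subgraph_def compatible_def wf_subcube wf_hypercube pverts_subcube parcs_subcube)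

text \<open>Passing to a subface: \<open>A\<close> holds the stars that are kept, those in
  \<open>T\<close> become ones, and the remaining stars become zeros.\<close>

lemma subcube_subgraph_subcube:
  assumes "A \<subseteq> P" "T \<subseteq> P"
  shows "subgraph (with_proj (subcube n A (S \<union> T))) (with_proj (subcube n P S))"
proof -
  have "pverts (subcube n A (S \<union> T)) \<subseteq> pverts (subcube n P S)"
    using assms by (auto simp: pverts_subcube)
  then show ?thesis
    by (auto simp: subgraph_def compatible_def wf_subcube parcs_subcube)
qed

text \<open>On sets of ones, \<phi> relabels coordinates along \<open>p\<close> and then reflects by
  \<open>B\<close>. Over the range of \<open>p\<close> every pattern occurs, while elsewhere the
  value stays that of \<open>B\<close>, hence the face. Arcs correspond because \<open>B\<close>
  cancels in a symmetric difference of two images and \<open>p\<close> is injective. This serves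
  both to realise a face as an embedding and to recognise an embedding as a face.\<close>

lemma
  assumes p: "inj_on p {..<d}" "p ` {..<d} \<subseteq> {..<n}"
    and len: "\<And>x. length x = d \<Longrightarrow> length (\<phi> x) = n"
    and ones: "\<And>x. length x = d \<Longrightarrow> ones (\<phi> x) = sym_diff B (p ` ones x)"
    and B: "B \<subseteq> {..<n}"
  shows image_pverts_hypercube:
      "\<phi> ` pverts (hypercube d) = pverts (subcube n (p ` {..<d}) (B - p ` {..<d}))" (is ?V)
    and image_parcs_hypercube:
      "map_prod \<phi> \<phi> ` parcs (hypercube d) = parcs (subcube n (p ` {..<d}) (B - p ` {..<d}))" (is ?A)
proof -
  show V: ?V
  proof (intro equalityI subsetI)
    fix y assume "y \<in> \<phi> ` pverts (hypercube d)"
    then obtain x where x: "length x = d" "y = \<phi> x" by auto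
    then have "p ` ones x \<subseteq> p ` {..<d}" using ones_subset by blast
    with x show "y \<in> pverts (subcube n (p ` {..<d}) (B - p ` {..<d}))"
      by (auto simp: pverts_subcube len ones)
  next
    fix y assume y: "y \<in> pverts (subcube n (p ` {..<d}) (B - p ` {..<d}))"
    \<comment> \<open>The preimage of \<open>y\<close>: coordinate \<open>i\<close> is set exactly
      when \<open>y\<close> and \<open>B\<close> disagree at \<open>p i\<close>. Outside the range
      of \<open>p\<close> they agree, since \<open>y\<close> lies in the face.\<close>
    define X where "X = {i \<in> {..<d}. p i \<in> sym_diff B (ones y)}"
    have X: "X \<subseteq> {..<d}" by (auto simp: X_def)
    have "p ` X = sym_diff B (ones y)"
      using y by (auto simp: X_def pverts_subcube)
    then have "ones (\<phi> (of_ones d X)) = ones y"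
      using X by (auto simp: ones)
    then have "\<phi> (of_ones d X) = y"
      using y len by (intro ones_inject) (auto simp: pverts_subcube)
    then show "y \<in> \<phi> ` pverts (hypercube d)"
      by (intro image_eqI[where x = "of_ones d X"]) simp_all
  qed
  have arc: "(\<phi> x, \<phi> y) \<in> parcs (hypercube n) \<longleftrightarrow> (x, y) \<in> parcs (hypercube d)"
    if "length x = d" "length y = d" for x y
  proof -
    have sub: "ones x \<subseteq> {..<d}" "ones y \<subseteq> {..<d}" using that by (simp_all add: ones_subset)
    have "sym_diff (ones (\<phi> x)) (ones (\<phi> y)) = sym_diff (p ` ones x) (p ` ones y)"
      using that by (auto simp: ones)
    also have "\<dots> = p ` sym_diff (ones x) (ones y)"
      using sub by (simp add: image_Un inj_on_image_set_diff[OF p(1)] subset_trans[OF Diff_subset])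
    finally have "card (sym_diff (ones (\<phi> x)) (ones (\<phi> y))) = card (sym_diff (ones x) (ones y))"
      using sub by (simp only:) (intro card_image inj_on_subset[OF p(1)], blast)
    then show ?thesis using that len by (simp add: parcs_hypercube)
  qed
  show ?A
  proof (intro equalityI subsetI)
    fix e assume "e \<in> map_prod \<phi> \<phi> ` parcs (hypercube d)"
    then obtain x y where xy: "(x, y) \<in> parcs (hypercube d)" "e = (\<phi> x, \<phi> y)" by auto
    then have "length x = d" "length y = d" by (auto simp: parcs_hypercube)
    with xy arc V show "e \<in> parcs (subcube n (p ` {..<d}) (B - p ` {..<d}))"
      by (auto simp: parcs_subcube)
  next
    fix e assume e: "e \<in> parcs (subcube n (p ` {..<d}) (B - p ` {..<d}))"
    then obtain x y where "e = (\<phi> x, \<phi> y)" "length x = d" "length y = d"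
      unfolding parcs_subcube V[symmetric] by auto
    with e arc show "e \<in> map_prod \<phi> \<phi> ` parcs (hypercube d)"
      by (auto simp: parcs_subcube intro!: image_eqI[where x = "(x, y)"])
  qed
qed

text \<open>Any enumeration \<open>p\<close> of the stars gives the isomorphism: copy the
  \<open>d\<close> bits to the stars and put ones at \<open>S\<close>.\<close>

lemma subcube_mem_embeddings:
  assumes "P \<subseteq> {..<n}" "S \<subseteq> {..<n} - P" "card P = d"
  shows "subcube n P S \<in> embeddings d n"
proof -
  have "finite P" using assms(1) finite_subset by blast
  with assms(3) obtain p where "bij_betw p {..<d} P"
    using ex_bij_betw_nat_finite[of P] by (auto simp: atLeast0LessThan)
  then have p: "inj_on p {..<d}" "p ` {..<d} = P" by (auto simp: bij_betw_def)
  define \<phi> where "\<phi> x = of_ones n (S \<union> p ` ones x)" for x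
  have sub: "p ` ones x \<subseteq> P" if "length x = d" for x
    using p(2) ones_subset[OF that] by blast
  have ones: "ones (\<phi> x) = S \<union> p ` ones x" if "length x = d" for x
    unfolding \<phi>_def using sub[OF that] assms by (intro ones_of_ones) blast
  \<comment> \<open>As \<open>S\<close> and \<open>P\<close> are disjoint, the union is a symmetric
    difference, and the image lemmas apply with \<open>S\<close> as \<open>B\<close>.\<close>
  have ones': "ones (\<phi> x) = sym_diff S (p ` ones x)" if "length x = d" for x
    using ones[OF that] sub[OF that] assms by blast
  have len: "length (\<phi> x) = n" for x by (simp add: \<phi>_def)
  have SP: "S - P = S" using assms by blast
  have S: "S \<subseteq> {..<n}" using assms by blast
  have inj: "inj_on \<phi> {x. length x = d}"
  proof (rule inj_onI)
    fix x y assume "x \<in> {x. length x = d}" "y \<in> {x. length x = d}" "\<phi> x = \<phi> y"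
    then have xy: "length x = d" "length y = d" "\<phi> x = \<phi> y" by auto
    then have "S \<union> p ` ones x = S \<union> p ` ones y"
      using ones by metis
    moreover have "p ` ones x \<subseteq> P" "p ` ones y \<subseteq> P" using sub xy by auto
    ultimately have "p ` ones x = p ` ones y" using assms(2) by blast
    then have "ones x = ones y"
      using inj_on_image_eq_iff[OF p(1)] ones_subset xy by metis
    then show "x = y" using xy by (intro ones_inject) auto
  qed
  define f where "f = \<lparr>iso_verts = \<phi>, iso_arcs = map_prod \<phi> \<phi>, iso_head = snd, iso_tail = fst\<rparr>"
  have "inj_on (map_prod \<phi> \<phi>) (parcs (hypercube d))"
    by (rule inj_on_subset[OF map_prod_inj_on[OF inj inj]]) (auto simp: parcs_hypercube)
  then have "pre_digraph.digraph_isomorphism (with_proj (hypercube d)) f"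
    by (auto simp: pre_digraph.digraph_isomorphism_def f_def wf_hypercube inj)
  moreover have "with_proj (subcube n P S) = app_iso f (with_proj (hypercube d))"
    using image_pverts_hypercube[of p d n \<phi> S] image_parcs_hypercube[of p d n \<phi> S] p assms(1) len ones' S SP
    by (simp add: app_iso_def f_def with_proj_def)
  ultimately show ?thesis
    unfolding embeddings_def digraph_iso_def using subcube_subgraph_hypercube by blast
qed

section \<open>Every embedded cube is a face\<close>

lemma sym_diff_insert: "a \<notin> Q \<Longrightarrow> sym_diff B (insert a Q) = sym_diff (sym_diff B Q) {a}"
  by blast

text \<open>The map \<open>p\<close> is read off at the neighbours of the empty set and propagated
  by induction on \<open>X\<close>. For distinct \<open>i\<close> and \<open>j\<close> in
  \<open>X\<close>, the sets \<open>Y = X - {i, j}\<close>, \<open>insert i Y\<close>,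
  \<open>insert j Y\<close> and \<open>X\<close> form a 4-cycle. The images of the middle two have
  just two common neighbours; injectivity rules out \<open>g Y\<close>, which leaves
  \<open>g Y\<close> with both \<open>p i\<close> and \<open>p j\<close> flipped.\<close>

lemma cube_map_rigid:
  fixes g :: "'a set \<Rightarrow> 'b set"
  assumes fin: "finite A"
    and inj: "inj_on g (Pow A)"
    and step: "\<And>X i. X \<subseteq> A \<Longrightarrow> i \<in> A - X \<Longrightarrow> \<exists>k. sym_diff (g X) (g (insert i X)) = {k}"
  obtains p where "inj_on p A" "\<And>X. X \<subseteq> A \<Longrightarrow> g X = sym_diff (g {}) (p ` X)"
proof -
  have "\<forall>i \<in> A. \<exists>k. sym_diff (g {}) (g {i}) = {k}"
    using step[of "{}"] by simp
  then obtain p where p: "\<And>i. i \<in> A \<Longrightarrow> sym_diff (g {}) (g {i}) = {p i}"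
    by metis
  have p1: "g {i} = sym_diff (g {}) {p i}" if "i \<in> A" for i
    using p[OF that] by blast
  have pinj: "inj_on p A"
  proof (rule inj_onI)
    fix i j assume ij: "i \<in> A" "j \<in> A" "p i = p j"
    then have "g {i} = g {j}" by (simp add: p1)
    then show "i = j" using inj_onD[OF inj, of "{i}" "{j}"] ij by simp
  qed
  have "g X = sym_diff (g {}) (p ` X)" if "X \<subseteq> A" for X
    using finite_subset[OF that fin] that
  proof (induction X rule: finite_psubset_induct)
    case (psubset X)
    consider "X = {}" | i where "X = {i}" | i j where "i \<in> X" "j \<in> X" "i \<noteq> j" by blast
    then show ?case
    proof cases
      case 1 then show ?thesis by simp
    next
      case 2 then show ?thesis using p1 psubset.prems by simp
    next
      case 3
      define Y where "Y = X - {i, j}"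
      have Y: "Y \<subseteq> A" "i \<notin> Y" "j \<notin> Y" "i \<in> A" "j \<in> A" "X = insert i (insert j Y)"
        using 3 psubset.prems by (auto simp: Y_def)
      have less: "Y \<subset> X" "insert i Y \<subset> X" "insert j Y \<subset> X"
        using 3 Y by blast+
      have lower: "g Y = sym_diff (g {}) (p ` Y)"
        "g (insert i Y) = sym_diff (g {}) (p ` insert i Y)"
        "g (insert j Y) = sym_diff (g {}) (p ` insert j Y)"
        using psubset.IH[of Y] psubset.IH[of "insert i Y"] psubset.IH[of "insert j Y"] Y less
        by simp_all
      obtain a where a: "sym_diff (g (insert i Y)) (g X) = {a}"
        using step[of "insert i Y" j] Y 3 by (auto simp: insert_commute)
      obtain b where b: "sym_diff (g (insert j Y)) (g X) = {b}"
        using step[of "insert j Y" i] Y 3 by auto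
      have ne: "g X \<noteq> g Y"
        using inj_onD[OF inj, of X Y] Y by blast
      have pij: "p i \<noteq> p j" "p i \<notin> p ` Y" "p j \<notin> p ` Y"
        using pinj Y 3 by (auto simp: inj_on_def)
      have i: "g (insert i Y) = sym_diff (g Y) {p i}" and j: "g (insert j Y) = sym_diff (g Y) {p j}"
        unfolding lower image_insert by (intro sym_diff_insert pij)+
      have ga: "g X = sym_diff (sym_diff (g Y) {p i}) {a}"
        using a unfolding i by blast
      have gb: "g X = sym_diff (sym_diff (g Y) {p j}) {b}"
        using b unfolding j by blast
      \<comment> \<open>Otherwise \<open>p i\<close> would be flipped twice, giving
        \<open>g X = g Y\<close>. So \<open>p i\<close> is really flipped along the first path;
        along the second, \<open>p j\<close> is a different coordinate, which forces
        \<open>b = p i\<close>.\<close>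
      have "a \<noteq> p i" using ga ne by blast
      then have "b = p i" using ga gb pij(1) by blast
      then have "g X = sym_diff (sym_diff (g {}) (p ` insert j Y)) {p i}"
        using gb j lower(3) by simp
      also have "\<dots> = sym_diff (g {}) (p ` X)"
        unfolding Y(6) image_insert[of p i] using pij by (intro sym_diff_insert[symmetric]) simp
      finally show ?thesis .
    qed
  qed
  with pinj that show thesis by blast
qed

text \<open>The isomorphism becomes a map \<open>g\<close> between sets of ones that changes one
  coordinate per step, so rigidity applies. The stars are the range of \<open>p\<close>, and the
  fixed ones are what remains of \<open>g {}\<close> outside it.\<close>

lemma embeddings_imp_subcube:
  assumes "H \<in> embeddings d n"
  obtains P S where "P \<subseteq> {..<n}" "S \<subseteq> {..<n} - P" "card P = d" "H = subcube n P S"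
proof -
  from assms obtain f where f: "pre_digraph.digraph_isomorphism (with_proj (hypercube d)) f"
    and H: "with_proj H = app_iso f (with_proj (hypercube d))"
    and sub: "subgraph (with_proj H) (with_proj (hypercube n))"
    by (auto simp: embeddings_def digraph_iso_def)
  define \<phi> where "\<phi> = iso_verts f"
  have V: "pverts H = \<phi> ` pverts (hypercube d)"
    using arg_cong[OF H, of verts] by (simp add: \<phi>_def)
  \<comment> \<open>An isomorphism carries a separate map on arcs. Since \<open>with_proj\<close>
    reads tail and head off the pair, that map must act as \<phi> on both endpoints.\<close>
  have ends: "iso_arcs f e = map_prod \<phi> \<phi> e" if "e \<in> parcs (hypercube d)" for e
    using f H that
    by (cases e; cases "iso_arcs f e")
      (auto simp: pre_digraph.digraph_isomorphism_def \<phi>_def app_iso_def with_proj_def)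
  then have A: "parcs H = map_prod \<phi> \<phi> ` parcs (hypercube d)"
    using arg_cong[OF H, of arcs] by simp
  have len: "length (\<phi> x) = n" if "length x = d" for x
  proof -
    have "\<phi> x \<in> pverts H" using V that by simp
    then show ?thesis using sub by (auto simp: subgraph_def)
  qed
  have inj: "inj_on \<phi> {x. length x = d}"
    using f by (simp add: pre_digraph.digraph_isomorphism_def \<phi>_def)
  define g where "g X = ones (\<phi> (of_ones d X))" for X
  have g_inj: "inj_on g (Pow {..<d})"
  proof (rule inj_onI)
    fix X Y assume XY: "X \<in> Pow {..<d}" "Y \<in> Pow {..<d}" "g X = g Y"
    then have "\<phi> (of_ones d X) = \<phi> (of_ones d Y)"
      using len by (intro ones_inject) (simp_all add: g_def)
    then have "of_ones d X = of_ones d Y" using inj by (auto dest: inj_onD)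
    then show "X = Y" using XY by (metis PowD ones_of_ones)
  qed
  have g_step: "\<exists>k. sym_diff (g X) (g (insert i X)) = {k}"
    if "X \<subseteq> {..<d}" "i \<in> {..<d} - X" for X i
  proof -
    have "sym_diff X (insert i X) = {i}" using that by auto
    then have "(of_ones d X, of_ones d (insert i X)) \<in> parcs (hypercube d)"
      using that by (simp add: parcs_hypercube)
    then have "(\<phi> (of_ones d X), \<phi> (of_ones d (insert i X))) \<in> parcs H"
      unfolding A by (metis image_eqI map_prod_simp)
    then have "(\<phi> (of_ones d X), \<phi> (of_ones d (insert i X))) \<in> parcs (hypercube n)"
      using sub by (auto simp: subgraph_def)
    then show ?thesis by (simp add: parcs_hypercube g_def card_1_singleton_iff)
  qed
  obtain p where p: "inj_on p {..<d}" "\<And>X. X \<subseteq> {..<d} \<Longrightarrow> g X = sym_diff (g {}) (p ` X)"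
    using cube_map_rigid[OF _ g_inj g_step] by auto
  have g_sub: "g X \<subseteq> {..<n}" for X
    unfolding g_def by (intro ones_subset len) simp
  \<comment> \<open>Each element of the range of \<open>p\<close> lies in exactly one of
    \<open>g {}\<close> and \<open>g {..<d}\<close>, and both are below \<open>n\<close>.\<close>
  have p_sub: "p ` {..<d} \<subseteq> {..<n}"
    using p(2)[of "{..<d}"] g_sub[of "{}"] g_sub[of "{..<d}"] by blast
  have ones: "ones (\<phi> x) = sym_diff (g {}) (p ` ones x)" if "length x = d" for x
    using p(2)[of "ones x"] that ones_subset[OF that] by (simp add: g_def)
  note im = p(1) p_sub len ones g_sub
  have "H = subcube n (p ` {..<d}) (g {} - p ` {..<d})"
    using image_pverts_hypercube[OF im] image_parcs_hypercube[OF im] V A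
    by (intro pair_pre_digraph.equality) simp_all
  moreover have "card (p ` {..<d}) = d" using p(1) by (simp add: card_image)
  moreover have "g {} - p ` {..<d} \<subseteq> {..<n} - p ` {..<d}" using g_sub by (intro Diff_mono) auto
  ultimately show thesis using that[of "p ` {..<d}"] p_sub by simp
qed

section \<open>The colouring of two-dimensional faces\<close>

text \<open>A colouring receives only the subgraph, so \<open>S\<close> and \<open>P\<close> must be
  recovered from its vertices: ones common to all vertices are fixed, and ones of only some vertices
  are stars.\<close>

definition fixed_ones :: "bool list pair_pre_digraph \<Rightarrow> nat set" where
  "fixed_ones H = \<Inter> (ones ` pverts H)"

definition stars :: "bool list pair_pre_digraph \<Rightarrow> nat set" where
  "stars H = \<Union> (ones ` pverts H) - fixed_ones H"

text \<open>For a face with two stars, \<open>Min\<close> and \<open>Max\<close> are those stars.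
  The last interval is unbounded, so the dimension \<open>n\<close> need not be known.\<close>

definition face_colour :: "bool list pair_pre_digraph \<Rightarrow> nat" where
  "face_colour H =
     (let S = fixed_ones H; p = Min (stars H); q = Max (stars H)
      in colour (card (S \<inter> {..<p})) (card (S \<inter> {p<..<q})) (card (S \<inter> {q<..})))"

lemma
  assumes "P \<subseteq> {..<n}" "S \<subseteq> {..<n} - P"
  shows fixed_ones_subcube: "fixed_ones (subcube n P S) = S"
    and stars_subcube: "stars (subcube n P S) = P"
proof -
  \<comment> \<open>The two extreme vertices: filling all stars with zeros attains the intersection,
    filling them with ones attains the union.\<close>
  have bot: "of_ones n S \<in> pverts (subcube n P S)" "ones (of_ones n S) = S"
   and top: "of_ones n (S \<union> P) \<in> pverts (subcube n P S)" "ones (of_ones n (S \<union> P)) = S \<union> P"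
  proof -
    have "S \<subseteq> {..<n}" "S \<union> P \<subseteq> {..<n}" using assms by blast+
    then show "ones (of_ones n S) = S" "ones (of_ones n (S \<union> P)) = S \<union> P" by simp_all
    then show "of_ones n S \<in> pverts (subcube n P S)" "of_ones n (S \<union> P) \<in> pverts (subcube n P S)"
      by (simp_all add: pverts_subcube)
  qed
  have bounds: "S \<subseteq> ones x \<and> ones x \<subseteq> S \<union> P" if "x \<in> pverts (subcube n P S)" for x
    using that by (simp add: pverts_subcube)
  have "fixed_ones (subcube n P S) \<subseteq> S"
    unfolding fixed_ones_def using INT_lower[OF bot(1), of ones] bot(2) by simp
  moreover have "S \<subseteq> fixed_ones (subcube n P S)"
    unfolding fixed_ones_def using bounds by (intro INT_greatest) blast
  ultimately show S: "fixed_ones (subcube n P S) = S" by simp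
  have "S \<union> P \<subseteq> \<Union> (ones ` pverts (subcube n P S))"
    using UN_upper[OF top(1), of ones] top(2) by simp
  moreover have "\<Union> (ones ` pverts (subcube n P S)) \<subseteq> S \<union> P"
    using bounds by (intro UN_least) blast
  ultimately have "\<Union> (ones ` pverts (subcube n P S)) = S \<union> P" by (rule equalityI[rotated])
  then show "stars (subcube n P S) = P"
    unfolding stars_def S using assms(2) by auto
qed

lemma face_colour_subcube:
  assumes "p < q" "q < n" "S \<subseteq> {..<n} - {p, q}"
  shows "face_colour (subcube n {p, q} S) =
    colour (card (S \<inter> {..<p})) (card (S \<inter> {p<..<q})) (card (S \<inter> {q<..}))"
  using assms by (simp add: face_colour_def fixed_ones_subcube stars_subcube)

section \<open>Gap counts in a four-dimensional face\<close>

text \<open>Used where a star that becomes fixed merges two neighbouring gaps: the new count is both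
  gap counts plus the value of that star.\<close>

lemma
  fixes X :: "nat set"
  assumes "finite X"
  shows card_split_lessThan:
      "p < q \<Longrightarrow> card (X \<inter> {..<q}) = card (X \<inter> {..<p}) + of_bool (p \<in> X) + card (X \<inter> {p<..<q})"
    and card_split_greaterThan:
      "p < q \<Longrightarrow> card (X \<inter> {p<..}) = card (X \<inter> {p<..<q}) + of_bool (q \<in> X) + card (X \<inter> {q<..})"
    and card_split_greaterThanLessThan:
      "p < q \<Longrightarrow> q < r \<Longrightarrow>
       card (X \<inter> {p<..<r}) = card (X \<inter> {p<..<q}) + of_bool (q \<in> X) + card (X \<inter> {q<..<r})"
proof -
  have split: "card (X \<inter> I) = card (X \<inter> J) + of_bool (p \<in> X) + card (X \<inter> K)"
    if "I = J \<union> {p} \<union> K" "J \<inter> K = {}" "p \<notin> J" "p \<notin> K" for I J K and p :: nat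
  proof -
    have "X \<inter> I = (X \<inter> J) \<union> (X \<inter> {p}) \<union> (X \<inter> K)" using that by blast
    moreover have "card (X \<inter> {p}) = of_bool (p \<in> X)" by (cases "p \<in> X") auto
    moreover have "card ((X \<inter> J) \<union> (X \<inter> {p})) = card (X \<inter> J) + card (X \<inter> {p})"
      using that assms by (intro card_Un_disjoint) auto
    moreover have "card ((X \<inter> J) \<union> (X \<inter> {p}) \<union> (X \<inter> K)) = card ((X \<inter> J) \<union> (X \<inter> {p})) + card (X \<inter> K)"
      using that assms by (intro card_Un_disjoint) auto
    ultimately show ?thesis by simp
  qed
  show "p < q \<Longrightarrow> card (X \<inter> {..<q}) = card (X \<inter> {..<p}) + of_bool (p \<in> X) + card (X \<inter> {p<..<q})"
    by (rule split) auto
  show "p < q \<Longrightarrow> card (X \<inter> {p<..}) = card (X \<inter> {p<..<q}) + of_bool (q \<in> X) + card (X \<inter> {q<..})"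
    by (rule split) auto
  show "p < q \<Longrightarrow> q < r \<Longrightarrow>
      card (X \<inter> {p<..<r}) = card (X \<inter> {p<..<q}) + of_bool (q \<in> X) + card (X \<inter> {q<..<r})"
    by (rule split) auto
qed

lemma card_4_sortedE:
  fixes P :: "nat set"
  assumes "card P = 4"
  obtains a b c d where "P = {a, b, c, d}" "a < b" "b < c" "c < d"
proof -
  have fin: "finite P" using assms card_ge_0_finite by force
  define xs where "xs = sorted_list_of_set P"
  have "length xs = 4" using assms by (simp add: xs_def)
  then obtain a b c d where "xs = [a, b, c, d]"
    by (auto simp: numeral_eq_Suc length_Suc_conv)
  moreover have "sorted_wrt (<) xs" "set xs = P" using fin by (simp_all add: xs_def)
  ultimately show thesis using that by auto
qed

text \<open>The check on \<open>hits\<close> tells which two stars to keep as \<open>A\<close> and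
  which values to give the other two; \<open>T\<close> collects those set to one.\<close>

lemma subcube_4_face_colour:
  assumes P: "P \<subseteq> {..<n}" "card P = 4" and S: "S \<subseteq> {..<n} - P" and k: "k < 5"
  shows "\<exists>A T. A \<subseteq> P \<and> card A = 2 \<and> T \<subseteq> P - A \<and> face_colour (subcube n A (S \<union> T)) = k"
proof -
  obtain a b c d where abcd: "P = {a, b, c, d}" "a < b" "b < c" "c < d"
    using P(2) by (rule card_4_sortedE)
  then have lt: "a < c" "a < d" "b < d" by simp_all
  define u v w x y where "u = card (S \<inter> {..<a})" and "v = card (S \<inter> {a<..<b})"
    and "w = card (S \<inter> {b<..<c})" and "x = card (S \<inter> {c<..<d})" and "y = card (S \<inter> {d<..})"
  note gap_defs = u_def v_def w_def x_def y_def
  have main: ?thesis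
    if "{p, q} \<subseteq> P" "p < q" "T \<subseteq> P - {p, q}" "face_colour (subcube n {p, q} (S \<union> T)) = k" for p q T
    using that by (intro exI[of _ "{p, q}"] exI[of _ T]) auto
  have fc: "face_colour (subcube n {p, q} (S \<union> T)) =
      colour (card ((S \<union> T) \<inter> {..<p})) (card ((S \<union> T) \<inter> {p<..<q})) (card ((S \<union> T) \<inter> {q<..}))"
    if "{p, q} \<subseteq> P" "p < q" "T \<subseteq> P - {p, q}" for p q T
  proof (rule face_colour_subcube)
    show "p < q" by fact
    show "q < n" using that P by blast
    show "S \<union> T \<subseteq> {..<n} - {p, q}" using that P S by blast
  qed
  \<comment> \<open>All of \<open>T\<close> consists of stars, and no star lies inside an open gap,
    so these five counts are those of \<open>S\<close> alone.\<close>
  have gaps: "card ((S \<union> T) \<inter> {..<a}) = u" "card ((S \<union> T) \<inter> {a<..<b}) = v"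
    "card ((S \<union> T) \<inter> {b<..<c}) = w" "card ((S \<union> T) \<inter> {c<..<d}) = x" "card ((S \<union> T) \<inter> {d<..}) = y"
    if "T \<subseteq> P" for T
    unfolding gap_defs using that abcd lt by (auto intro!: arg_cong[where f = card])
  have fin: "finite (S \<union> T)" if "T \<subseteq> P" for T
    using that S P(1) by (intro finite_subset[of "S \<union> T" "{..<n}"]) auto
  have notin: "a \<notin> S" "b \<notin> S" "c \<notin> S" "d \<notin> S"
    using S abcd(1) by auto
  have left_b: "card ((S \<union> T) \<inter> {..<b}) = u + of_bool (a \<in> T) + v"
    and left_c: "card ((S \<union> T) \<inter> {..<c}) = u + of_bool (a \<in> T) + v + of_bool (b \<in> T) + w"
    and mid_ac: "card ((S \<union> T) \<inter> {a<..<c}) = v + of_bool (b \<in> T) + w"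
    and mid_ad: "card ((S \<union> T) \<inter> {a<..<d}) = v + of_bool (b \<in> T) + w + of_bool (c \<in> T) + x"
    and mid_bd: "card ((S \<union> T) \<inter> {b<..<d}) = w + of_bool (c \<in> T) + x"
    and right_c: "card ((S \<union> T) \<inter> {c<..}) = x + of_bool (d \<in> T) + y"
    and right_b: "card ((S \<union> T) \<inter> {b<..}) = w + of_bool (c \<in> T) + x + of_bool (d \<in> T) + y"
    if "T \<subseteq> P" for T
    using card_split_lessThan[OF fin[OF that] abcd(2)] card_split_lessThan[OF fin[OF that] abcd(3)]
      card_split_greaterThanLessThan[OF fin[OF that] abcd(2) abcd(3)]
      card_split_greaterThanLessThan[OF fin[OF that] lt(1) abcd(4)]
      card_split_greaterThanLessThan[OF fin[OF that] abcd(3) abcd(4)]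
      card_split_greaterThan[OF fin[OF that] abcd(3)] card_split_greaterThan[OF fin[OF that] abcd(4)]
    by (simp_all add: gaps[OF that] notin)
  obtain s t :: nat where st: "s \<in> {0, 1}" "t \<in> {0, 1}" and "hits k u v w x y s t"
    using ex_hits[OF k, of u v w x y] by blast
  \<comment> \<open>Turns the bits into a set: \<open>s\<close> is the value at star
    \<open>i\<close> and \<open>t\<close> the value at star \<open>j\<close>.\<close>
  define T where "T i j = {r. r = i \<and> s = 1 \<or> r = j \<and> t = 1}" for i j :: nat
  have T_sub: "T i j \<subseteq> {i, j}" for i j by (auto simp: T_def)
  have T: "of_bool (i \<in> T i j) = s" "of_bool (j \<in> T i j) = t" if "i < j" for i j
    using st that by (auto simp: T_def)
  from \<open>hits k u v w x y s t\<close>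
  consider "colour u v (w + s + x + t + y) = k" | "colour u (v + s + w) (x + t + y) = k"
    | "colour u (v + s + w + t + x) y = k" | "colour (u + s + v) w (x + t + y) = k"
    | "colour (u + s + v) (w + t + x) y = k" | "colour (u + s + v + t + w) x y = k"
    unfolding hits_def by blast
  then show ?thesis
  \<comment> \<open>The kept pairs come in the order ab, ac, ad, bc, bd, cd. The complementary pair
    is passed to \<open>T\<close> with its smaller star first, matching the order of
    \<open>s\<close> and \<open>t\<close> in \<open>hits\<close>.\<close>
  proof cases
    case 1
    have sub: "{a, b} \<subseteq> P" "T c d \<subseteq> P - {a, b}" "T c d \<subseteq> P" using T_sub[of c d] abcd lt by auto
    show ?thesis using 1 abcd lt
      by (intro main[OF sub(1) _ sub(2)]) (simp_all add: fc[OF sub(1) _ sub(2)] gaps[OF sub(3)] right_b[OF sub(3)] T)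
  next
    case 2
    have sub: "{a, c} \<subseteq> P" "T b d \<subseteq> P - {a, c}" "T b d \<subseteq> P" using T_sub[of b d] abcd lt by auto
    show ?thesis using 2 abcd lt
      by (intro main[OF sub(1) _ sub(2)]) (simp_all add: fc[OF sub(1) _ sub(2)] gaps[OF sub(3)]
          mid_ac[OF sub(3)] right_c[OF sub(3)] T)
  next
    case 3
    have sub: "{a, d} \<subseteq> P" "T b c \<subseteq> P - {a, d}" "T b c \<subseteq> P" using T_sub[of b c] abcd lt by auto
    show ?thesis using 3 abcd lt
      by (intro main[OF sub(1) _ sub(2)]) (simp_all add: fc[OF sub(1) _ sub(2)] gaps[OF sub(3)]
          mid_ad[OF sub(3)] T)
  next
    case 4
    have sub: "{b, c} \<subseteq> P" "T a d \<subseteq> P - {b, c}" "T a d \<subseteq> P" using T_sub[of a d] abcd lt by auto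
    show ?thesis using 4 abcd lt
      by (intro main[OF sub(1) _ sub(2)]) (simp_all add: fc[OF sub(1) _ sub(2)] gaps[OF sub(3)]
          left_b[OF sub(3)] right_c[OF sub(3)] T)
  next
    case 5
    have sub: "{b, d} \<subseteq> P" "T a c \<subseteq> P - {b, d}" "T a c \<subseteq> P" using T_sub[of a c] abcd lt by auto
    show ?thesis using 5 abcd lt
      by (intro main[OF sub(1) _ sub(2)]) (simp_all add: fc[OF sub(1) _ sub(2)] gaps[OF sub(3)]
          left_b[OF sub(3)] mid_bd[OF sub(3)] T)
  next
    case 6
    have sub: "{c, d} \<subseteq> P" "T a b \<subseteq> P - {c, d}" "T a b \<subseteq> P" using T_sub[of a b] abcd lt by auto
    show ?thesis using 6 abcd lt
      by (intro main[OF sub(1) _ sub(2)]) (simp_all add: fc[OF sub(1) _ sub(2)] gaps[OF sub(3)]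
          left_c[OF sub(3)] T)
  qed
qed

section \<open>The lower bound for the polychromatic number\<close>

lemma polychromatic_face_colour: "polychromatic 2 4 n 5 face_colour"
  unfolding polychromatic_def
proof (intro conjI ballI allI impI)
  show "face_colour E < 5" for E
    by (simp add: face_colour_def Let_def colour_less)
next
  fix D k assume "D \<in> embeddings 4 n" and k: "k < (5::nat)"
  then obtain P S where P: "P \<subseteq> {..<n}" "S \<subseteq> {..<n} - P" "card P = 4" and D: "D = subcube n P S"
    using embeddings_imp_subcube by blast
  obtain A T where AT: "A \<subseteq> P" "card A = 2" "T \<subseteq> P - A" "face_colour (subcube n A (S \<union> T)) = k"
    using subcube_4_face_colour[OF P(1,3,2) k] by blast
  have "subcube n A (S \<union> T) \<in> embeddings 2 n"
    using AT P by (intro subcube_mem_embeddings) blast+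
  moreover have "subgraph (with_proj (subcube n A (S \<union> T))) (with_proj D)"
    unfolding D using AT by (intro subcube_subgraph_subcube) blast+
  ultimately show "\<exists>E \<in> embeddings 2 n. subgraph (with_proj E) (with_proj D) \<and> face_colour E = k"
    using AT(4) by blast
qed

text \<open>By the classification of embeddings, each is named by a pair of subsets of
  \<open>{..<n}\<close>.\<close>

lemma finite_embeddings: "finite (embeddings d n)"
proof (rule finite_subset)
  show "embeddings d n \<subseteq> (\<lambda>(P, S). subcube n P S) ` (Pow {..<n} \<times> Pow {..<n})"
  proof
    fix H assume "H \<in> embeddings d n"
    then obtain P S where "P \<subseteq> {..<n}" "S \<subseteq> {..<n} - P" "H = subcube n P S"
      by (rule embeddings_imp_subcube)
    then show "H \<in> (\<lambda>(P, S). subcube n P S) ` (Pow {..<n} \<times> Pow {..<n})"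
      by (intro image_eqI[where x = "(P, S)"]) auto
  qed
qed simp

text \<open>In dimension \<open>d\<close> the whole cube is itself an embedding, so each of the
  \<open>r\<close> colours is taken by some copy in it. The bound does not depend on
  \<open>c\<close>, which makes the greatest \<open>r\<close> exist.\<close>

lemma polychromatic_le_card_embeddings:
  assumes "polychromatic i d d r c"
  shows "r \<le> card (embeddings i d)"
proof -
  have "subcube d {..<d} {} \<in> embeddings d d"
    by (rule subcube_mem_embeddings) auto
  then have "{..<r} \<subseteq> c ` embeddings i d"
    using assms unfolding polychromatic_def by blast
  then have "card {..<r} \<le> card (c ` embeddings i d)"
    by (intro card_mono finite_imageI finite_embeddings)
  also have "\<dots> \<le> card (embeddings i d)"
    by (intro card_image_le finite_embeddings)
  finally show ?thesis by simp
qed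

theorem theorem22:
  shows "polychromatic_number 2 4 \<ge> 5"
  unfolding polychromatic_number_def
\<comment> \<open>\<open>GREATEST\<close> dominates 5 only if the admissible \<open>r\<close> are
  bounded; the instance \<open>n = 4\<close> supplies the bound.\<close>
proof (rule Greatest_le_nat)
  show "\<forall>n \<ge> 4. \<exists>c. polychromatic 2 4 n 5 c"
    using polychromatic_face_colour by blast
  show "r \<le> card (embeddings 2 4)" if "\<forall>n \<ge> 4. \<exists>c. polychromatic 2 4 n r c" for r
    using that polychromatic_le_card_embeddings by blast
qed

end
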